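(* Let $n\ge 1$ be an integer, $\kappa>0$, and let $C\subseteq \mathbb{H}^n_\kappa$ be a closed $\kappa$-hyperbolically convex set. Let $p\in C$, $0\neq v\in T_p\mathbb{H}^n_\kappa$ and $\alpha>0$. Then $$\big\langle v,\ \log^\kappa_p P^\kappa_C(\exp^\kappa_p(-\alpha v))\big\rangle\le -\frac1\alpha\, d_\kappa^2\big(p,P^\kappa_C(\exp^\kappa_p(-\alpha v))\big).$$
   Context: For $x,y\in\mathbb{R}^{n+1}$ the Lorentzian inner product is $\langle x,y\rangle:=x_1y_1+\dots+x_ny_n-x_{n+1}y_{n+1}$. The $\kappa$-hyperbolic space form is $\mathbb{H}^n_\kappa:=\{p\in\mathbb{R}^{n+1}:\langle p,p\rangle=-1/\kappa,\ p_{n+1}>0\}$, with tangent space $T_p\mathbb{H}^n_\kappa:=\{v\in\mathbb{R}^{n+1}:\langle p,v\rangle=0\}$, on which $\langle\cdot,\cdot\rangle$ is positive definite, with norm $\|v\|=\sqrt{\langle v,v\rangle}$. The intrinsic distance is $d_\kappa(p,q):=\frac{1}{\sqrt\kappa}\operatorname{arcosh}(-\kappa\langle p,q\rangle)$. Exponential map: $\exp^\kappa_p(0)=p$ and $\exp^\kappa_p(v)=\cosh(\sqrt\kappa\|v\|)\,p+\sinh(\sqrt\kappa\|v\|)\frac{v}{\sqrt\kappa\|v\|}$ for $0\ne v\in T_p\mathbb{H}^n_\kappa$. Its inverse is $\log^\kappa_p p=0$ and $\log^\kappa_p q=d_\kappa(p,q)\frac{q+\kappa\langle p,q\rangle p}{\|q+\kappa\langle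 p,q\rangle p\|}$ for $q\ne p$. The geodesic segment joining $p$ to $q$ is $\{\exp^\kappa_p(t\log^\kappa_p q):t\in[0,1]\}$. A set $C\subseteq\mathbb{H}^n_\kappa$ is $\kappa$-hyperbolically convex if for all $p,q\in C$ the geodesic segment joining $p$ to $q$ is contained in $C$. For a nonempty closed $\kappa$-hyperbolically convex set $C$, the intrinsic $\kappa$-projection $P^\kappa_C(p)$ of $p\in\mathbb{H}^n_\kappa$ is the unique minimizer of $q\mapsto d_\kappa(p,q)$ over $q\in C$. *)

theory Defs
  imports "HOL-Analysis.Analysis"
begin

(* R^(n+1) with n = CARD('n), split as (x_1, ..., x_n) paired with x_(n+1).  A finite
   index type is nonempty, so n >= 1 holds automatically. *)
type_synonym 'n lorentz_space = "(real ^ 'n) \<times> real"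

definition lorentz :: "'n::finite lorentz_space \<Rightarrow> 'n lorentz_space \<Rightarrow> real" where
  "lorentz x y = fst x \<bullet> fst y - snd x * snd y"

(* A genuine norm only on tangent spaces of the hyperboloid, where the form is
   positive definite. *)
definition lorentz_norm :: "'n::finite lorentz_space \<Rightarrow> real" where
  "lorentz_norm v = sqrt (lorentz v v)"

definition hyp_space :: "real \<Rightarrow> 'n::finite lorentz_space set" where
  "hyp_space \<kappa> = {p. lorentz p p = - 1 / \<kappa> \<and> snd p > 0}"

definition hyp_tangent :: "'n::finite lorentz_space \<Rightarrow> 'n lorentz_space set" where
  "hyp_tangent p = {v. lorentz p v = 0}"

definition hyp_dist :: "real \<Rightarrow> 'n::finite lorentz_space \<Rightarrow> 'n lorentz_space \<Rightarrow> real" where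
  "hyp_dist \<kappa> p q = 1 / sqrt \<kappa> * arcosh (- \<kappa> * lorentz p q)"

definition hyp_exp ::
    "real \<Rightarrow> 'n::finite lorentz_space \<Rightarrow> 'n lorentz_space \<Rightarrow> 'n lorentz_space" where
  "hyp_exp \<kappa> p v =
    (if v = 0 then p
     else cosh (sqrt \<kappa> * lorentz_norm v) *\<^sub>R p
        + (sinh (sqrt \<kappa> * lorentz_norm v) / (sqrt \<kappa> * lorentz_norm v)) *\<^sub>R v)"

definition hyp_log ::
    "real \<Rightarrow> 'n::finite lorentz_space \<Rightarrow> 'n lorentz_space \<Rightarrow> 'n lorentz_space" where
  "hyp_log \<kappa> p q =
    (if q = p then 0
     else (let u = q + (\<kappa> * lorentz p q) *\<^sub>R p
           in (hyp_dist \<kappa> p q / lorentz_norm u) *\<^sub>R u))"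

definition hyp_segment ::
    "real \<Rightarrow> 'n::finite lorentz_space \<Rightarrow> 'n lorentz_space \<Rightarrow> 'n lorentz_space set" where
  "hyp_segment \<kappa> p q = (\<lambda>t. hyp_exp \<kappa> p (t *\<^sub>R hyp_log \<kappa> p q)) ` {0..1}"

definition hyp_convex :: "real \<Rightarrow> 'n::finite lorentz_space set \<Rightarrow> bool" where
  "hyp_convex \<kappa> C \<longleftrightarrow>
    C \<subseteq> hyp_space \<kappa> \<and> (\<forall>p\<in>C. \<forall>q\<in>C. hyp_segment \<kappa> p q \<subseteq> C)"

(* Definite description rather than arg_min_on: any fact about the value needs both
   existence and uniqueness of the minimizer. *)
definition hyp_proj ::
    "real \<Rightarrow> 'n::finite lorentz_space set \<Rightarrow> 'n lorentz_space \<Rightarrow> 'n lorentz_space" where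
  "hyp_proj \<kappa> C p = (THE q. is_arg_min (hyp_dist \<kappa> p) (\<lambda>q. q \<in> C) q)"

end

theory Submission
  imports Defs
begin

text \<open>
  Write \<open>q\<close> for the exponential of \<open>w = - \<alpha> v\<close> at \<open>p\<close> and \<open>z\<close> for the projection of \<open>q\<close>.
  Minimality of \<open>z\<close> along the geodesic from \<open>z\<close> to a point \<open>y\<close> of the convex set gives
  \<open>\<langle>q, y\<rangle> + \<kappa> \<langle>z, y\<rangle> \<langle>q, z\<rangle> \<le> 0\<close>, which says that the angle at \<open>z\<close> is at least a right angle.
  With \<open>a, b, c\<close> the distances \<open>qz\<close>, \<open>pz\<close>, \<open>pq\<close> (scaled to curvature \<open>-1\<close>) and \<open>y = p\<close> this reads
  \<open>cosh a * cosh b \<le> cosh c\<close>, and the law of cosines at \<open>p\<close> turns it into \<open>tanh b / tanh c \<le> cos A\<close>,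
  \<open>A\<close> being the angle at \<open>p\<close>. As \<open>x / tanh x\<close> is increasing and \<open>b \<le> c\<close>, it follows that
  \<open>b \<le> c * cos A\<close>, which is the claim.
\<close>

section \<open>Hyperbolic functions\<close>

text \<open>The derivative of x * coth x is (sinh x * cosh x - x) / (sinh x)^2, which is nonnegative
  because x \<le> sinh x \<le> sinh x * cosh x for x > 0.\<close>

lemma mono_x_coth:
  fixes b c :: real
  assumes "0 < b" "b \<le> c"
  shows "b * cosh b / sinh b \<le> c * cosh c / sinh c"
proof (rule DERIV_nonneg_imp_nondecreasing[OF assms(2)])
  fix x :: real
  assume "b \<le> x" "x \<le> c"
  with assms(1) have x: "0 < x" by linarith
  have "x \<le> sinh x"
    using real_le_x_sinh[of x] x by (simp add: sinh_field_def exp_minus)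
  also have "\<dots> \<le> sinh x * cosh x"
    using x by (simp add: cosh_real_ge_1)
  finally have *: "0 \<le> (sinh x * cosh x - x) / (sinh x)\<^sup>2"
    by simp
  have "((\<lambda>x. x * cosh x / sinh x) has_real_derivative
      ((cosh x + x * sinh x) * sinh x - x * cosh x * cosh x) / (sinh x * sinh x)) (at x)"
    using x by (auto intro!: derivative_eq_intros)
  also have "(cosh x + x * sinh x) * sinh x - x * cosh x * cosh x
      = sinh x * cosh x - x * ((cosh x)\<^sup>2 - (sinh x)\<^sup>2)"
    by (simp add: algebra_simps power2_eq_square)
  finally show "\<exists>y. ((\<lambda>x. x * cosh x / sinh x) has_real_derivative y) (at x) \<and> 0 \<le> y"
    using * unfolding hyperbolic_pythagoras by (auto simp: power2_eq_square)
qed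

text \<open>The function f(s) = cosh s * X + sinh s * Y has slope Y at 0, where it is minimal.
  Instead of differentiating, put s = 2r: f(2r) - f(0) = 2 * sinh r * (sinh r * X + cosh r * Y), so
  the bracket is nonnegative for small r > 0, and it tends to Y.\<close>

lemma nonneg_slope_of_cosh_sinh_min:
  fixes X Y b :: real
  assumes "0 < b" and min: "\<And>s. 0 < s \<Longrightarrow> s \<le> b \<Longrightarrow> X \<le> cosh s * X + sinh s * Y"
  shows "0 \<le> Y"
proof -
  have pos: "0 \<le> sinh r * X + cosh r * Y" if r: "0 < r" "r < b / 2" for r
  proof -
    have "0 \<le> cosh (2 * r) * X - X + sinh (2 * r) * Y"
      using min[of "2 * r"] r by simp
    also have "\<dots> = 2 * sinh r * (sinh r * X + cosh r * Y)"
      by (simp only: cosh_double sinh_double cosh_square_eq)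
        (simp add: algebra_simps power2_eq_square)
    finally show ?thesis
      using r by (simp add: zero_le_mult_iff)
  qed
  have "((\<lambda>r. sinh r * X + cosh r * Y) \<longlongrightarrow> sinh 0 * X + cosh 0 * Y) (at_right 0)"
    by (intro tendsto_intros)
  moreover have "eventually (\<lambda>r. 0 \<le> sinh r * X + cosh r * Y) (at_right 0)"
    using eventually_at_right_real[of 0 "b / 2"] assms(1)
    by (auto elim!: eventually_mono intro: pos)
  ultimately show ?thesis
    using tendsto_lowerbound[of _ _ "at_right (0 :: real)"] by simp
qed

section \<open>The Lorentzian form\<close>

lemma lorentz_commute: "lorentz x y = lorentz y x"
  by (simp add: lorentz_def inner_commute)

lemma lorentz_self: "lorentz x x = (norm (fst x))\<^sup>2 - (snd x)\<^sup>2"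
  by (simp add: lorentz_def power2_norm_eq_inner flip: power2_eq_square)

lemma lorentz_add_right [simp]: "lorentz x (y + z) = lorentz x y + lorentz x z"
  by (simp add: lorentz_def inner_add_right algebra_simps)

lemma lorentz_scaleR_right [simp]: "lorentz x (r *\<^sub>R y) = r * lorentz x y"
  by (simp add: lorentz_def algebra_simps)

lemma lorentz_add_left [simp]: "lorentz (x + y) z = lorentz x z + lorentz y z"
  by (simp add: lorentz_def inner_add_left algebra_simps)

lemma lorentz_scaleR_left [simp]: "lorentz (r *\<^sub>R x) y = r * lorentz x y"
  by (simp add: lorentz_def algebra_simps)

lemma lorentz_zero [simp]: "lorentz x 0 = 0" "lorentz 0 x = 0"
  by (simp_all add: lorentz_def)

lemma continuous_on_lorentz [continuous_intros]:
  fixes f g :: "'a::topological_space \<Rightarrow> 'n::finite lorentz_space"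
  assumes "continuous_on S f" "continuous_on S g"
  shows "continuous_on S (\<lambda>x. lorentz (f x) (g x))"
  unfolding lorentz_def by (intro continuous_intros assms)

lemma timelike_norm_less:
  assumes "lorentz x x < 0"
  shows "norm (fst x) < \<bar>snd x\<bar>"
proof -
  have "(norm (fst x))\<^sup>2 < \<bar>snd x\<bar>\<^sup>2"
    using assms by (simp add: lorentz_self)
  then show ?thesis
    by (rule power2_less_imp_less) simp
qed

text \<open>Orthogonality and Cauchy-Schwarz bound
  \<open>\<bar>snd p\<bar> * \<bar>snd v\<bar>\<close> by the product of the spatial norms. As
  \<open>norm (fst p)\<close> is below \<open>\<bar>snd p\<bar>\<close>, this forces
  \<open>\<bar>snd v\<bar>\<close> below \<open>norm (fst v)\<close>.\<close>

lemma lorentz_pos_if_orthogonal_timelike: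
  assumes "lorentz p p < 0" "lorentz p v = 0" "v \<noteq> 0"
  shows "0 < lorentz v v"
proof -
  have p: "norm (fst p) < \<bar>snd p\<bar>"
    by (rule timelike_norm_less) fact
  have "\<bar>snd p\<bar> * \<bar>snd v\<bar> = \<bar>fst p \<bullet> fst v\<bar>"
    using assms(2) by (simp add: lorentz_def flip: abs_mult)
  also have "\<dots> \<le> norm (fst p) * norm (fst v)"
    by (rule Cauchy_Schwarz_ineq2)
  finally have le: "\<bar>snd p\<bar> * \<bar>snd v\<bar> \<le> norm (fst p) * norm (fst v)" .
  have "fst v \<noteq> 0"
  proof
    assume "fst v = 0"
    moreover from this le p have "snd v = 0"
      by (auto simp: mult_le_0_iff)
    ultimately show False
      using \<open>v \<noteq> 0\<close> by (simp add: prod_eq_iff)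
  qed
  then have "norm (fst p) * norm (fst v) < \<bar>snd p\<bar> * norm (fst v)"
    using p by simp
  with le have "\<bar>snd p\<bar> * \<bar>snd v\<bar> < \<bar>snd p\<bar> * norm (fst v)"
    by linarith
  then have "\<bar>snd v\<bar> < norm (fst v)"
    by (simp add: mult_less_cancel_left)
  then have "\<bar>snd v\<bar>\<^sup>2 < (norm (fst v))\<^sup>2"
    by (rule power_strict_mono) auto
  then show ?thesis
    by (simp add: lorentz_self)
qed

lemma lorentz_neg_if_future_timelike:
  assumes "lorentz x x < 0" "lorentz y y < 0" "0 < snd x" "0 < snd y"
  shows "lorentz x y < 0"
proof -
  have "norm (fst x) < snd x" "norm (fst y) < snd y"
    using timelike_norm_less assms by fastforce+
  then have "norm (fst x) * norm (fst y) < snd x * snd y"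
    by (intro mult_strict_mono) (use assms in auto)
  then show ?thesis
    using norm_cauchy_schwarz[of "fst x" "fst y"] by (simp add: lorentz_def)
qed

lemma future_if_lorentz_neg:
  assumes "lorentz x x < 0" "lorentz y y < 0" "0 < snd x" "lorentz x y < 0"
  shows "0 < snd y"
proof (rule ccontr)
  assume "\<not> 0 < snd y"
  moreover have "snd y \<noteq> 0"
    using timelike_norm_less[OF assms(2)] by auto
  \<comment> \<open>The reflected vector is future timelike. It is written as a scalar multiple so
    that the scaling rule can pull out its sign.\<close>
  ultimately have "lorentz x (- 1 *\<^sub>R y) < 0"
    using assms(1,2,3) lorentz_neg_if_future_timelike[of x "- 1 *\<^sub>R y"]
    by (simp add: lorentz_def)
  with assms(4) show False
    unfolding lorentz_scaleR_right by simp
qed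

section \<open>The hyperboloid\<close>

context
  fixes \<kappa> :: real
  assumes \<kappa>: "\<kappa> > 0"
begin

lemma hyp_space_timelike: "x \<in> hyp_space \<kappa> \<Longrightarrow> lorentz x x < 0"
  using \<kappa> by (simp add: hyp_space_def)

lemma lorentz_self_hyp: "x \<in> hyp_space \<kappa> \<Longrightarrow> \<kappa> * lorentz x x = - 1"
  using \<kappa> by (simp add: hyp_space_def)

text \<open>Since \<kappa> times the form of \<open>x\<close> with itself is -1, \<open>u\<close> is
  the component of \<open>y\<close> orthogonal to \<open>x\<close>. It is the initial direction of
  the geodesic from \<open>x\<close> to \<open>y\<close>.\<close>

lemma hyp_direction:
  assumes "x \<in> hyp_space \<kappa>" "y \<in> hyp_space \<kappa>"
  defines "u \<equiv> y + (\<kappa> * lorentz x y) *\<^sub>R x"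
  shows "lorentz x u = 0"
    and "\<kappa> * lorentz u u = (\<kappa> * lorentz x y)\<^sup>2 - 1"
proof -
  have "lorentz x u = lorentz x y * (1 + \<kappa> * lorentz x x)"
    by (simp add: u_def algebra_simps)
  then show "lorentz x u = 0"
    using lorentz_self_hyp[OF assms(1)] by simp
  then have "\<kappa> * lorentz u u = \<kappa> * lorentz y u"
    by (subst u_def) simp
  also have "\<dots> = \<kappa> * lorentz y y + (\<kappa> * lorentz x y)\<^sup>2"
    by (simp add: u_def lorentz_commute[of y x] algebra_simps power2_eq_square)
  finally show "\<kappa> * lorentz u u = (\<kappa> * lorentz x y)\<^sup>2 - 1"
    using lorentz_self_hyp[OF assms(2)] by simp
qed

text \<open>The tangential component \<open>?u\<close> has positive square unless it vanishes, and
  \<kappa> times that square is \<open>?X\<^sup>2 - 1\<close>. If it vanished, \<open>y\<close>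
  would be a positive multiple of \<open>x\<close> with the same square, hence equal to
  \<open>x\<close>.\<close>

lemma hyp_lorentz_gt_1:
  assumes x: "x \<in> hyp_space \<kappa>" and y: "y \<in> hyp_space \<kappa>" and "x \<noteq> y"
  shows "1 < - \<kappa> * lorentz x y"
proof -
  let ?X = "- \<kappa> * lorentz x y"
  let ?u = "y + (\<kappa> * lorentz x y) *\<^sub>R x"
  have "lorentz x y < 0"
    using lorentz_neg_if_future_timelike[OF x[THEN hyp_space_timelike] y[THEN hyp_space_timelike]]
      x y by (simp add: hyp_space_def)
  with \<kappa> have X: "0 < ?X"
    by (simp add: mult_pos_neg)
  have "?u \<noteq> 0"
  proof
    assume "?u = 0"
    then have yx: "y = ?X *\<^sub>R x"
      by (simp add: eq_neg_iff_add_eq_0)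
    have "\<kappa> * lorentz y y = ?X\<^sup>2 * (\<kappa> * lorentz x x)"
      by (subst (1 2) yx)
        (simp only: lorentz_scaleR_left lorentz_scaleR_right power2_eq_square mult_ac)
    then have "?X\<^sup>2 = 1"
      unfolding lorentz_self_hyp[OF x] lorentz_self_hyp[OF y] by simp
    with X have "?X = 1"
      by (auto simp: power2_eq_1_iff)
    then have "y = 1 *\<^sub>R x"
      using yx by metis
    with \<open>x \<noteq> y\<close> show False
      by simp
  qed
  then have "0 < \<kappa> * lorentz ?u ?u"
    using lorentz_pos_if_orthogonal_timelike[OF hyp_space_timelike[OF x] hyp_direction(1)[OF x y]] \<kappa>
    by simp
  then have "1\<^sup>2 < ?X\<^sup>2"
    using hyp_direction(2)[OF x y] by simp
  then show ?thesis
    using X by (intro power2_less_imp_less[of 1]) auto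
qed

lemma hyp_lorentz_ge_1:
  "x \<in> hyp_space \<kappa> \<Longrightarrow> y \<in> hyp_space \<kappa> \<Longrightarrow> 1 \<le> - \<kappa> * lorentz x y"
  using hyp_lorentz_gt_1[of x y] lorentz_self_hyp[of x] by (cases "x = y") auto

lemma cosh_hyp_dist:
  assumes "x \<in> hyp_space \<kappa>" "y \<in> hyp_space \<kappa>"
  shows "cosh (sqrt \<kappa> * hyp_dist \<kappa> x y) = - \<kappa> * lorentz x y"
  using hyp_lorentz_ge_1[OF assms] \<kappa> by (simp add: hyp_dist_def)

text \<open>As arcosh is strictly increasing on [1, \<infinity>), minimizing the distance to
  \<open>q\<close> means maximizing the linear function \<open>lorentz q\<close>.\<close>

lemma hyp_dist_less_iff:
  assumes "q \<in> hyp_space \<kappa>" "x \<in> hyp_space \<kappa>" "y \<in> hyp_space \<kappa>"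
  shows "hyp_dist \<kappa> q x < hyp_dist \<kappa> q y \<longleftrightarrow> lorentz q y < lorentz q x"
  using hyp_lorentz_ge_1[OF assms(1,2)] hyp_lorentz_ge_1[OF assms(1,3)] \<kappa>
  by (simp add: hyp_dist_def divide_strict_right_mono divide_less_cancel)

lemma hyp_dist_self: "x \<in> hyp_space \<kappa> \<Longrightarrow> hyp_dist \<kappa> x x = 0"
  using lorentz_self_hyp[of x] by (simp add: hyp_dist_def)

lemma hyp_dist_pos:
  assumes "x \<in> hyp_space \<kappa>" "y \<in> hyp_space \<kappa>" "x \<noteq> y"
  shows "0 < hyp_dist \<kappa> x y"
  using hyp_lorentz_gt_1[OF assms] \<kappa> by (simp add: hyp_dist_def)

section \<open>Exponential map, logarithm and geodesic segments\<close>

lemma hyp_exp_in_hyp_space: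
  assumes p: "p \<in> hyp_space \<kappa>" and w: "w \<in> hyp_tangent p"
  shows "hyp_exp \<kappa> p w \<in> hyp_space \<kappa>"
proof (cases "w = 0")
  case True
  with p show ?thesis by (simp add: hyp_exp_def)
next
  case False
  define c where "c = sqrt \<kappa> * lorentz_norm w"
  have pw: "lorentz p w = 0" "lorentz w p = 0"
    using w by (simp_all add: hyp_tangent_def lorentz_commute)
  have ww: "0 < lorentz w w"
    using lorentz_pos_if_orthogonal_timelike[OF hyp_space_timelike[OF p] pw(1) False] .
  have c: "0 < c" and c2: "\<kappa> * lorentz w w = c\<^sup>2"
    using ww \<kappa> by (simp_all add: c_def lorentz_norm_def power_mult_distrib)
  define e where "e = hyp_exp \<kappa> p w"
  have e: "e = cosh c *\<^sub>R p + (sinh c / c) *\<^sub>R w"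
    using False by (simp add: e_def hyp_exp_def c_def)
  have "\<kappa> * lorentz e e = (cosh c)\<^sup>2 * (\<kappa> * lorentz p p) + (sinh c / c)\<^sup>2 * (\<kappa> * lorentz w w)"
    by (simp add: e pw power2_eq_square algebra_simps)
  also have "\<dots> = - 1"
    using c hyperbolic_pythagoras[of c]
    by (simp add: lorentz_self_hyp[OF p] c2 power_divide)
  finally have ee: "\<kappa> * lorentz e e = - 1" .
  have "lorentz e e = - 1 / \<kappa>"
    using ee \<kappa> by (simp add: field_simps)
  \<comment> \<open>The negative product with \<open>p\<close> places \<open>e\<close> on the upper
    sheet.\<close>
  moreover have "lorentz p e < 0"
    using hyp_space_timelike[OF p] by (simp add: e pw mult_pos_neg)
  moreover have "0 < snd p"
    using p by (simp add: hyp_space_def)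
  ultimately have "0 < snd e"
    using future_if_lorentz_neg[OF hyp_space_timelike[OF p], of e] \<kappa> by simp
  with \<open>lorentz e e = - 1 / \<kappa>\<close> show ?thesis
    by (simp add: hyp_space_def flip: e_def)
qed

lemma lorentz_norm_hyp_direction:
  assumes "x \<in> hyp_space \<kappa>" "y \<in> hyp_space \<kappa>"
  shows "sqrt \<kappa> * lorentz_norm (y + (\<kappa> * lorentz x y) *\<^sub>R x) = sinh (sqrt \<kappa> * hyp_dist \<kappa> x y)"
proof -
  have "sinh (sqrt \<kappa> * hyp_dist \<kappa> x y) = sqrt ((- \<kappa> * lorentz x y)\<^sup>2 - 1)"
    using hyp_lorentz_ge_1[OF assms] \<kappa> by (simp add: hyp_dist_def sinh_arcosh_real)
  also have "\<dots> = sqrt (\<kappa> * lorentz (y + (\<kappa> * lorentz x y) *\<^sub>R x) (y + (\<kappa> * lorentz x y) *\<^sub>R x))"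
    by (subst hyp_direction(2)[OF assms]) simp
  finally show ?thesis
    by (simp only: lorentz_norm_def real_sqrt_mult)
qed

text \<open>The direction vector has norm \<open>sinh b / sqrt \<kappa>\<close>, so the factor
  \<open>sqrt \<kappa>\<close> cancels in the coefficient of the logarithm.\<close>

lemma hyp_log_eq:
  fixes x y :: "'n::finite lorentz_space"
  assumes "x \<in> hyp_space \<kappa>" "y \<in> hyp_space \<kappa>" "x \<noteq> y"
  defines "b \<equiv> sqrt \<kappa> * hyp_dist \<kappa> x y"
  shows "hyp_log \<kappa> x y = (b / sinh b) *\<^sub>R (y + (\<kappa> * lorentz x y) *\<^sub>R x)"
proof -
  define u where "u = y + (\<kappa> * lorentz x y) *\<^sub>R x"
  have "sinh b = sqrt \<kappa> * lorentz_norm u"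
    unfolding b_def u_def by (rule lorentz_norm_hyp_direction[OF assms(1,2), symmetric])
  then have "b / sinh b = hyp_dist \<kappa> x y / lorentz_norm u"
    using \<kappa> by (simp add: b_def)
  then show ?thesis
    using assms(3) by (simp add: hyp_log_def Let_def flip: u_def)
qed

text \<open>The segment is parametrized by scaled arc length, the original parameter being
  \<open>s / b\<close>. Requiring s > 0 keeps the tangent vector nonzero.\<close>

lemma hyp_segment_point:
  fixes x y :: "'n::finite lorentz_space"
  assumes xy: "x \<in> hyp_space \<kappa>" "y \<in> hyp_space \<kappa>" "x \<noteq> y"
  defines "b \<equiv> sqrt \<kappa> * hyp_dist \<kappa> x y"
  assumes s: "0 < s" "s \<le> b"
  shows "cosh s *\<^sub>R x + (sinh s / sinh b) *\<^sub>R (y + (\<kappa> * lorentz x y) *\<^sub>R x) \<in> hyp_segment \<kappa> x y"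
proof -
  define u where "u = y + (\<kappa> * lorentz x y) *\<^sub>R x"
  define w where "w = (s / b) *\<^sub>R hyp_log \<kappa> x y"
  have b: "0 < b"
    using s by linarith
  have w: "w = (s / sinh b) *\<^sub>R u"
    using b by (simp add: w_def hyp_log_eq[OF xy] b_def u_def)
  have u: "sqrt \<kappa> * lorentz_norm u = sinh b"
    unfolding u_def b_def by (rule lorentz_norm_hyp_direction) fact+
  have "lorentz_norm w = (s / sinh b) * lorentz_norm u"
    using s b by (simp add: w lorentz_norm_def real_sqrt_mult real_sqrt_divide)
  then have "sqrt \<kappa> * lorentz_norm w = (s / sinh b) * (sqrt \<kappa> * lorentz_norm u)"
    by simp
  then have norm_w: "sqrt \<kappa> * lorentz_norm w = s"
    unfolding u using b by simp
  then have "w \<noteq> 0"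
    using s by (auto simp: lorentz_norm_def)
  then have "hyp_exp \<kappa> x w = cosh s *\<^sub>R x + (sinh s / sinh b) *\<^sub>R u"
    using s by (simp add: hyp_exp_def norm_w) (simp add: w)
  moreover have "hyp_exp \<kappa> x w \<in> hyp_segment \<kappa> x y"
    using s b by (auto simp: hyp_segment_def w_def)
  ultimately show ?thesis
    by (simp add: u_def)
qed

section \<open>The projection\<close>

lemma hyp_arg_min_iff:
  assumes "C \<subseteq> hyp_space \<kappa>" "q \<in> hyp_space \<kappa>"
  shows "is_arg_min (hyp_dist \<kappa> q) (\<lambda>x. x \<in> C) z
    \<longleftrightarrow> z \<in> C \<and> (\<forall>x\<in>C. lorentz q x \<le> lorentz q z)"
proof -
  have "hyp_dist \<kappa> q x < hyp_dist \<kappa> q z \<longleftrightarrow> lorentz q z < lorentz q x"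
    if "x \<in> C" "z \<in> C" for x
    using assms that by (intro hyp_dist_less_iff) auto
  then show ?thesis
    unfolding is_arg_min_def by (metis not_less)
qed

text \<open>Along the geodesic from \<open>z\<close> to \<open>y\<close>, the negated product with
  \<open>q\<close> has the form cosh s * X + sinh s * Y with Y =
  \<open>- lorentz q u / sinh b\<close>. Minimality at s = 0 gives Y \<ge> 0. For
  \<open>z = y\<close> the left-hand side is zero.\<close>

lemma minimizer_obtuse:
  assumes C: "hyp_convex \<kappa> C" and q: "q \<in> hyp_space \<kappa>"
    and min: "is_arg_min (hyp_dist \<kappa> q) (\<lambda>x. x \<in> C) z" and y: "y \<in> C"
  shows "lorentz q y + \<kappa> * lorentz z y * lorentz q z \<le> 0"
proof (cases "z = y")
  case True
  have "z \<in> hyp_space \<kappa>"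
    using C y True by (auto simp: hyp_convex_def)
  then show ?thesis
    using lorentz_self_hyp[of z] True by simp
next
  case False
  define u where "u = y + (\<kappa> * lorentz z y) *\<^sub>R z"
  define b where "b = sqrt \<kappa> * hyp_dist \<kappa> z y"
  have z: "z \<in> C" and CH: "C \<subseteq> hyp_space \<kappa>"
    using min C by (auto simp: is_arg_min_def hyp_convex_def)
  have zH: "z \<in> hyp_space \<kappa>" and yH: "y \<in> hyp_space \<kappa>"
    using z y CH by auto
  have b: "0 < b"
    using hyp_dist_pos[OF zH yH False] \<kappa> by (simp add: b_def)
  have "0 \<le> - lorentz q u / sinh b"
  proof (rule nonneg_slope_of_cosh_sinh_min[OF b])
    fix s assume s: "0 < s" "s \<le> b"
    let ?x = "cosh s *\<^sub>R z + (sinh s / sinh b) *\<^sub>R u"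
    have x: "?x \<in> C"
      using hyp_segment_point[OF zH yH False, of s] s C z y
      by (auto simp: hyp_convex_def b_def u_def)
    then have "lorentz q ?x \<le> lorentz q z"
      using min hyp_arg_min_iff[OF CH q] by blast
    then show "- lorentz q z \<le> cosh s * (- lorentz q z) + sinh s * (- lorentz q u / sinh b)"
      by simp
  qed
  then have "lorentz q u \<le> 0"
    using b by (simp add: divide_le_0_iff)
  then show ?thesis
    by (simp add: u_def)
qed

text \<open>For two distinct minimizers the obtuse-angle inequality reads
  \<open>lorentz q z * (1 + \<kappa> * lorentz z y) \<le> 0\<close>, yet both factors are
  negative.\<close>

lemma minimizer_unique:
  assumes C: "hyp_convex \<kappa> C" and q: "q \<in> hyp_space \<kappa>"
    and z: "is_arg_min (hyp_dist \<kappa> q) (\<lambda>x. x \<in> C) z"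
    and y: "is_arg_min (hyp_dist \<kappa> q) (\<lambda>x. x \<in> C) y"
  shows "y = z"
proof (rule ccontr)
  assume ne: "y \<noteq> z"
  have CH: "C \<subseteq> hyp_space \<kappa>"
    using C by (simp add: hyp_convex_def)
  have mem: "y \<in> C" "z \<in> C" "y \<in> hyp_space \<kappa>" "z \<in> hyp_space \<kappa>"
    using z y CH by (auto simp: is_arg_min_def)
  have eq: "lorentz q y = lorentz q z"
    using z y mem(1,2) hyp_arg_min_iff[OF CH q] by (metis antisym)
  have "lorentz q z * (1 + \<kappa> * lorentz z y) \<le> 0"
    using minimizer_obtuse[OF C q z mem(1)] eq by (simp add: algebra_simps)
  moreover have "lorentz q z < 0"
  proof (rule ccontr)
    assume "\<not> lorentz q z < 0"
    then have "0 \<le> \<kappa> * lorentz q z"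
      using \<kappa> by simp
    then show False
      using hyp_lorentz_ge_1[OF q mem(4)] by simp
  qed
  moreover have "1 + \<kappa> * lorentz z y < 0"
    using hyp_lorentz_gt_1[OF mem(4,3)] ne by simp
  ultimately show False
    using mult_neg_neg by fastforce
qed

section \<open>Existence of the projection\<close>

text \<open>A timelike vector has nonzero last coordinate, so the open condition
  \<open>snd x > 0\<close> may be relaxed to a closed one.\<close>

lemma closed_hyp_space: "closed (hyp_space \<kappa> :: 'n::finite lorentz_space set)"
proof -
  have "snd x \<noteq> 0" if "lorentz x x = - 1 / \<kappa>" for x :: "'n lorentz_space"
    using timelike_norm_less[of x] that \<kappa> by auto
  then have "hyp_space \<kappa> =
      {x :: 'n lorentz_space. lorentz x x = - 1 / \<kappa>} \<inter> {x. 0 \<le> snd x}"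
    by (auto simp: hyp_space_def less_le)
  moreover have "closed {x :: 'n lorentz_space. lorentz x x = - 1 / \<kappa>}"
    by (intro closed_Collect_eq continuous_intros)
  moreover have "closed {x :: 'n lorentz_space. 0 \<le> snd x}"
    by (intro closed_Collect_le continuous_intros)
  ultimately show ?thesis
    by (simp add: closed_Int)
qed

text \<open>These sets are balls around \<open>q\<close>. The gap
  \<open>snd q - norm (fst q)\<close> is positive because \<open>q\<close> lies strictly inside the
  light cone, and it bounds \<open>snd x\<close>.\<close>

lemma bounded_hyp_sublevel:
  fixes q :: "'n::finite lorentz_space"
  assumes q: "q \<in> hyp_space \<kappa>"
  shows "bounded {x \<in> hyp_space \<kappa>. r \<le> lorentz q x}"
proof (rule boundedI)
  fix x assume "x \<in> {x \<in> hyp_space \<kappa>. r \<le> lorentz q x}"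
  then have x: "x \<in> hyp_space \<kappa>" and r: "r \<le> lorentz q x"
    by auto
  have nq: "norm (fst q) < snd q" and nx: "norm (fst x) < snd x"
    using timelike_norm_less[OF hyp_space_timelike] q x by (fastforce simp: hyp_space_def)+
  have "fst q \<bullet> fst x \<le> norm (fst q) * norm (fst x)"
    by (rule norm_cauchy_schwarz)
  also have "\<dots> \<le> norm (fst q) * snd x"
    using nx by (intro mult_left_mono) auto
  finally have "snd x * (snd q - norm (fst q)) \<le> - r"
    using r by (simp add: lorentz_def algebra_simps)
  then have "snd x \<le> - r / (snd q - norm (fst q))"
    using nq by (subst pos_le_divide_eq) auto
  moreover have "norm x \<le> norm (fst x) + norm (snd x)"
    using norm_Pair_le[of "fst x" "snd x"] by simp
  moreover have "0 < snd x"
    using x by (simp add: hyp_space_def)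
  \<comment> \<open>The factor 2 arises because both components of \<open>x\<close> have norm at
    most \<open>snd x\<close>.\<close>
  ultimately show "norm x \<le> 2 * (- r / (snd q - norm (fst q)))"
    using nx by simp
qed

text \<open>Cutting \<open>C\<close> at the level of \<open>p\<close> leaves a nonempty compact set,
  on which \<open>lorentz q\<close> attains its maximum. The points cut off have smaller values than
  \<open>p\<close>.\<close>

lemma minimizer_exists:
  fixes C :: "'n::finite lorentz_space set"
  assumes CH: "C \<subseteq> hyp_space \<kappa>" and cl: "closedin (top_of_set (hyp_space \<kappa>)) C"
    and p: "p \<in> C" and q: "q \<in> hyp_space \<kappa>"
  shows "\<exists>z. is_arg_min (hyp_dist \<kappa> q) (\<lambda>x. x \<in> C) z"
proof -
  let ?K = "C \<inter> {x. lorentz q p \<le> lorentz q x}"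
  have "closed C"
    using cl closed_hyp_space closedin_closed_trans by blast
  moreover have "closed {x. lorentz q p \<le> lorentz q x}"
    by (intro closed_Collect_le continuous_intros)
  moreover have "bounded ?K"
    by (rule bounded_subset[OF bounded_hyp_sublevel[OF q, of "lorentz q p"]]) (use CH in auto)
  ultimately have "compact ?K"
    by (simp add: compact_eq_bounded_closed closed_Int)
  moreover have "continuous_on ?K (lorentz q)"
    by (intro continuous_intros)
  moreover have "?K \<noteq> {}"
    using p by auto
  ultimately obtain z where z: "z \<in> ?K" "\<forall>x\<in>?K. lorentz q x \<le> lorentz q z"
    using continuous_attains_sup by metis
  then have "lorentz q x \<le> lorentz q z" if "x \<in> C" for x
    using that by (cases "x \<in> ?K") auto
  with z(1) show ?thesis
    using hyp_arg_min_iff[OF CH q] by blast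
qed

lemma hyp_proj_is_arg_min:
  fixes C :: "'n::finite lorentz_space set"
  assumes "closedin (top_of_set (hyp_space \<kappa>)) C" "hyp_convex \<kappa> C" "p \<in> C" "q \<in> hyp_space \<kappa>"
  shows "is_arg_min (hyp_dist \<kappa> q) (\<lambda>x. x \<in> C) (hyp_proj \<kappa> C q)"
  unfolding hyp_proj_def
proof (rule theI')
  have "C \<subseteq> hyp_space \<kappa>"
    using assms(2) by (simp add: hyp_convex_def)
  then show "\<exists>!z. is_arg_min (hyp_dist \<kappa> q) (\<lambda>x. x \<in> C) z"
    using minimizer_exists[OF _ assms(1,3,4)] minimizer_unique[OF assms(2,4)] by blast
qed

section \<open>Law of cosines at \<open>p\<close> and the bound on the logarithm\<close>

lemma lorentz_hyp_log_ge_if_obtuse: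
  assumes p: "p \<in> hyp_space \<kappa>" and z: "z \<in> hyp_space \<kappa>"
    and w: "w \<in> hyp_tangent p" and "w \<noteq> 0"
    and obtuse: "lorentz (hyp_exp \<kappa> p w) p + \<kappa> * lorentz z p * lorentz (hyp_exp \<kappa> p w) z \<le> 0"
  shows "(hyp_dist \<kappa> p z)\<^sup>2 \<le> lorentz w (hyp_log \<kappa> p z)"
proof (cases "p = z")
  case True
  then show ?thesis
    by (simp add: hyp_dist_self[OF z] hyp_log_def)
next
  case False
  define b where "b = sqrt \<kappa> * hyp_dist \<kappa> p z"
  define c where "c = sqrt \<kappa> * lorentz_norm w"
  define q where "q = hyp_exp \<kappa> p w"
  \<comment> \<open>With A the angle at \<open>p\<close>, \<open>m\<close> equals c * sinh b * cos
    A.\<close>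
  define m where "m = \<kappa> * lorentz w z"
  have pw: "lorentz p w = 0" "lorentz w p = 0"
    using w by (simp_all add: hyp_tangent_def lorentz_commute)
  have c: "0 < c"
    using lorentz_pos_if_orthogonal_timelike[OF hyp_space_timelike[OF p] pw(1) \<open>w \<noteq> 0\<close>] \<kappa>
    by (simp add: c_def lorentz_norm_def)
  have b: "0 < b"
    using hyp_dist_pos[OF p z False] \<kappa> by (simp add: b_def)
  have cosh_b: "cosh b = - \<kappa> * lorentz p z"
    unfolding b_def by (rule cosh_hyp_dist[OF p z])
  have q: "q = cosh c *\<^sub>R p + (sinh c / c) *\<^sub>R w"
    using \<open>w \<noteq> 0\<close> by (simp add: q_def hyp_exp_def c_def)
  have qH: "q \<in> hyp_space \<kappa>"
    unfolding q_def by (rule hyp_exp_in_hyp_space[OF p w])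
  have "\<kappa> * lorentz q p = cosh c * (\<kappa> * lorentz p p)"
    by (simp add: q pw)
  then have qp: "- \<kappa> * lorentz q p = cosh c"
    using lorentz_self_hyp[OF p] by simp
  \<comment> \<open>Here \<open>a\<close> is the hyperbolic cosine of the scaled distance from
    \<open>q\<close> to \<open>z\<close>, not that distance itself; the next equation is the law of
    cosines.\<close>
  define a where "a = - \<kappa> * lorentz q z"
  have a: "a = cosh c * cosh b - sinh c / c * m"
    by (simp add: a_def q cosh_b m_def algebra_simps add_divide_distrib)
  have "0 \<le> - \<kappa> * (lorentz q p + \<kappa> * lorentz z p * lorentz q z)"
    using obtuse \<kappa> by (simp add: mult_nonneg_nonpos q_def)
  also have "\<dots> = - \<kappa> * lorentz q p - (- \<kappa> * lorentz q z) * (- \<kappa> * lorentz p z)"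
    by (simp add: algebra_simps lorentz_commute[of z p])
  also have "\<dots> = cosh c - a * cosh b"
    by (simp only: qp cosh_b a_def)
  finally have acute: "a * cosh b \<le> cosh c"
    by simp
  \<comment> \<open>This yields b \<le> c: the side opposite the obtuse angle is the longer
    one.\<close>
  have "1 \<le> a"
    unfolding a_def by (rule hyp_lorentz_ge_1[OF qH z])
  then have "cosh b \<le> a * cosh b"
    using mult_right_mono[of 1 a "cosh b"] by simp
  with acute have "cosh b \<le> cosh c"
    by linarith
  then have bc: "b \<le> c"
    using b c by (simp add: cosh_real_nonneg_le_iff)
  have "cosh c * ((cosh b)\<^sup>2 - 1) \<le> cosh b * (sinh c / c * m)"
    using acute by (simp add: a power2_eq_square algebra_simps)
  then have "cosh c * (sinh b)\<^sup>2 \<le> cosh b * sinh c * m / c"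
    by (simp add: cosh_square_eq)
  then have "c * cosh c * (sinh b)\<^sup>2 \<le> cosh b * sinh c * m"
    using c by (simp add: field_simps)
  then have "c * cosh c / sinh c * (sinh b)\<^sup>2 \<le> cosh b * m"
    using c by (simp add: field_simps)
  \<comment> \<open>Monotonicity of x * coth x replaces \<open>c\<close> by \<open>b\<close>, so
    that only \<open>b\<close> and \<open>m\<close> remain.\<close>
  moreover have "b * cosh b / sinh b * (sinh b)\<^sup>2 \<le> c * cosh c / sinh c * (sinh b)\<^sup>2"
    using mono_x_coth[OF b bc] by (rule mult_right_mono) simp
  ultimately have "b * cosh b / sinh b * (sinh b)\<^sup>2 \<le> cosh b * m"
    by linarith
  then have "cosh b * (b * sinh b) \<le> cosh b * m"
    using b by (simp add: power2_eq_square mult_ac)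
  then have "b * sinh b \<le> m"
    by simp
  then have "b * b * sinh b \<le> b * m"
    using b by simp
  then have "b\<^sup>2 \<le> b / sinh b * m"
    using b by (simp add: pos_le_divide_eq power2_eq_square)
  \<comment> \<open>The logarithm is \<open>b / sinh b\<close> times a combination of
    \<open>z\<close> and \<open>p\<close>, and the \<open>p\<close> part is orthogonal to
    \<open>w\<close>.\<close>
  also have "\<dots> = \<kappa> * lorentz w (hyp_log \<kappa> p z)"
    by (simp add: hyp_log_eq[OF p z False] b_def m_def pw)
  finally have "\<kappa> * (hyp_dist \<kappa> p z)\<^sup>2 \<le> \<kappa> * lorentz w (hyp_log \<kappa> p z)"
    using \<kappa> by (simp add: b_def power_mult_distrib)
  then show ?thesis
    using \<kappa> by simp
qed

end

theorem proposition8: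
  fixes \<kappa> \<alpha> :: real
    and C :: "'n::finite lorentz_space set"
    and p v :: "'n lorentz_space"
  assumes "\<kappa> > 0"
    and "C \<subseteq> hyp_space \<kappa>"
    and "closedin (top_of_set (hyp_space \<kappa>)) C"
    and "hyp_convex \<kappa> C"
    and "p \<in> C"
    and "v \<in> hyp_tangent p"
    and "v \<noteq> 0"
    and "\<alpha> > 0"
  shows "lorentz v (hyp_log \<kappa> p (hyp_proj \<kappa> C (hyp_exp \<kappa> p (- \<alpha> *\<^sub>R v))))
    \<le> - (1 / \<alpha>) * (hyp_dist \<kappa> p (hyp_proj \<kappa> C (hyp_exp \<kappa> p (- \<alpha> *\<^sub>R v))))\<^sup>2"
proof -
  define w where "w = - \<alpha> *\<^sub>R v"
  define z where "z = hyp_proj \<kappa> C (hyp_exp \<kappa> p w)"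
  have p: "p \<in> hyp_space \<kappa>"
    using assms by auto
  have w: "w \<in> hyp_tangent p" "w \<noteq> 0"
    \<comment> \<open>Without the deletion the sign would leave the scalar, and the scaling rule for
      the form would no longer apply.\<close>
    using assms(6-8) by (simp_all add: w_def hyp_tangent_def del: scaleR_minus_left)
  have q: "hyp_exp \<kappa> p w \<in> hyp_space \<kappa>"
    by (rule hyp_exp_in_hyp_space[OF assms(1) p w(1)])
  have min: "is_arg_min (hyp_dist \<kappa> (hyp_exp \<kappa> p w)) (\<lambda>x. x \<in> C) z"
    unfolding z_def by (rule hyp_proj_is_arg_min[OF assms(1,3,4,5) q])
  then have "z \<in> hyp_space \<kappa>"
    using assms(2) by (auto simp: is_arg_min_def)
  then have "(hyp_dist \<kappa> p z)\<^sup>2 \<le> lorentz w (hyp_log \<kappa> p z)"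
    using lorentz_hyp_log_ge_if_obtuse[OF assms(1) p _ w]
      minimizer_obtuse[OF assms(1,4) q min assms(5)] by blast
  \<comment> \<open>Division by the negative number -\<alpha> reverses the inequality and gives the
    claim.\<close>
  also have "\<dots> = - \<alpha> * lorentz v (hyp_log \<kappa> p z)"
    unfolding w_def by (rule lorentz_scaleR_left)
  finally have "lorentz v (hyp_log \<kappa> p z) \<le> - (1 / \<alpha>) * (hyp_dist \<kappa> p z)\<^sup>2"
    using assms(8) by (simp add: field_simps)
  then show ?thesis
    by (simp only: z_def w_def)
qed

end
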